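(* There exist a Banach space $\mathbb{X}$ and a basis $\mathcal{B}=(\boldsymbol{x}_n)_{n=1}^\infty$ of $\mathbb{X}$ that is equivalent to the canonical basis of $\ell_1$, satisfies Property (A), but fails to be $1$-suppression unconditional. Moreover, $\mathcal{B}$ is $1$-symmetric and $1$-bidemocratic.
   Context: Banach spaces are over $\mathbb{F}=\mathbb{R}$ or $\mathbb{C}$; $\mathbb{E}=\{\lambda\in\mathbb{F}:|\lambda|=1\}$. Basis: a basis of a Banach space $\mathbb{X}$ is a sequence $\mathcal{B}=(\boldsymbol{x}_n)_{n=1}^\infty$ in $\mathbb{X}$ whose linear span is dense in $\mathbb{X}$, for which there is a (necessarily unique) sequence $\mathcal{B}^*=(\boldsymbol{x}_n^* )_{n=1}^\infty$ in $\mathbb{X}^*$ biorthogonal to $\mathcal{B}$, and such that $\sup_n\max\{\|\boldsymbol{x}_n\|,\|\boldsymbol{x}_n^*\|\}<\infty$. Equivalence to the canonical basis of $\ell_1$: there is $C\ge1$ with $C^{-1}\sum_n|a_n|\le\|\sum_n a_n\boldsymbol{x}_n\|\le C\sum_n|a_n|$ for all $(a_n)\in c_{00}$ (finitely supported scalar sequences). Notation: $\operatorname{supp}(f)=\{n:\boldsymbol{x}_n^*(f)\ne0\}$; for finite $A\subset\mathbb{N}$ and $\varepsilon=(\varepsilon_n)_n$ in $\mathbb{E}$ indexed by a set containing $A$, $\mathbb{1}_{\varepsilon,A}=\sum_{n\in A}\varepsilon_n\boldsymbol{x}_n$ and $\mathbb{1}^*_{\varepsilon,A}=\sum_{n\in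 A}\varepsilon_n\boldsymbol{x}^*_n$; $S_A(x)=\sum_{n\in A}\boldsymbol{x}_n^*(x)\boldsymbol{x}_n$. Property (A): $\|\mathbb{1}_{\varepsilon,A}+f\|\le\|\mathbb{1}_{\varepsilon,B}+f\|$ for all $f\in\mathbb{X}$ with $\max_n|\boldsymbol{x}_n^*(f)|\le1$, all $A,B\subset\mathbb{N}$ with $|A|\le|B|<\infty$ and $A\cap B=A\cap\operatorname{supp}(f)=B\cap\operatorname{supp}(f)=\emptyset$, and all $\varepsilon\in\mathbb{E}^{A\cup B}$. $K$-suppression unconditional: $\|S_A(x)\|\le K\|x\|$ for all finite $A\subset\mathbb{N}$ and all $x\in\mathbb{X}$. $C$-symmetric: $\|\sum_n a_n\boldsymbol{x}_n\|\le C\|\sum_n a_n\boldsymbol{x}_{\pi(n)}\|$ for all $(a_n)\in c_{00}$ and all permutations $\pi$ of $\mathbb{N}$. $C$-bidemocratic: $\|\mathbb{1}_{\varepsilon,A}\|\,\|\mathbb{1}^*_{\delta,B}\|\le Cm$ for all $m\in\mathbb{N}$, all $A,B\subset\mathbb{N}$ with $\max\{|A|,|B|\}\le m$, all $\varepsilon\in\mathbb{E}^A$ and $\delta\in\mathbb{E}^B$ (norms in $\mathbb{X}$ and $\mathbb{X}^*$ respectively). *)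

theory Defs
  imports "HOL-Analysis.Analysis" "HOL-Library.Function_Algebras"
begin

text \<open>
  Normed and Banach spaces are carrier-based, since types cannot be quantified existentially
  and the library's type-class \<open>banach\<close> only covers real scalars. The scalar field
  \<open>'f\<close> is meant to be instantiated with \<open>real\<close> or \<open>complex\<close>.
  The values of \<open>N\<close> outside the carrier \<open>V\<close> are irrelevant.
\<close>

locale normed_vs = vector_space scale
  for scale :: "'f::real_normed_field \<Rightarrow> 'v::ab_group_add \<Rightarrow> 'v" +
  fixes V :: "'v set" and N :: "'v \<Rightarrow> real"
  assumes carrier_subspace: "subspace V"
    and norm_eq_0: "f \<in> V \<Longrightarrow> N f = 0 \<longleftrightarrow> f = 0"
    and norm_scale: "f \<in> V \<Longrightarrow> N (scale c f) = norm c * N f"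
    and norm_triangle: "f \<in> V \<Longrightarrow> g \<in> V \<Longrightarrow> N (f + g) \<le> N f + N g"
begin

text \<open>
  The locale \<open>Metric_space\<close> requires nonnegativity and symmetry of the distance also
  off the carrier, hence the conditional.
\<close>

definition ndist :: "'v \<Rightarrow> 'v \<Rightarrow> real" where
  "ndist f g = (if f \<in> V \<and> g \<in> V then N (f - g) else 0)"

lemma norm_minus: "f \<in> V \<Longrightarrow> N (- f) = N f"
  using norm_scale[of f "-1"] by (simp add: scale_minus_left)

lemma norm_nonneg: "f \<in> V \<Longrightarrow> 0 \<le> N f"
proof -
  assume f: "f \<in> V"
  have "N 0 = 0"
    using norm_eq_0 carrier_subspace subspace_0 by blast
  moreover have "N (f + - f) \<le> N f + N (- f)"
    using f carrier_subspace subspace_neg norm_triangle by blast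
  ultimately show ?thesis
    using norm_minus[OF f] by simp
qed

sublocale mspace: Metric_space V ndist
proof
  fix f g h
  have diff: "u - v \<in> V" if "u \<in> V" "v \<in> V" for u v
    using that carrier_subspace subspace_diff by blast
  show "0 \<le> ndist f g"
    by (simp add: ndist_def diff norm_nonneg)
  show "ndist f g = ndist g f"
    using norm_minus[of "f - g"] diff by (simp add: ndist_def)
  show "ndist f g = 0 \<longleftrightarrow> f = g" if "f \<in> V" "g \<in> V"
    using that diff norm_eq_0 by (simp add: ndist_def)
  show "ndist f h \<le> ndist f g + ndist g h" if "f \<in> V" "g \<in> V" "h \<in> V"
    using that diff norm_triangle[of "f - g" "g - h"] by (simp add: ndist_def)
qed

text \<open>
  Elements of the dual are represented by functions on the whole type of which only the
  restriction to \<open>V\<close> matters.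
\<close>

definition dual :: "('v \<Rightarrow> 'f) set" where
  "dual = {\<phi>. (\<forall>f\<in>V. \<forall>g\<in>V. \<phi> (f + g) = \<phi> f + \<phi> g) \<and>
              (\<forall>c. \<forall>f\<in>V. \<phi> (scale c f) = c * \<phi> f) \<and>
              (\<exists>K. \<forall>f\<in>V. norm (\<phi> f) \<le> K * N f)}"

definition dual_norm :: "('v \<Rightarrow> 'f) \<Rightarrow> real" where
  "dual_norm \<phi> = (SUP f\<in>{f \<in> V. N f \<le> 1}. norm (\<phi> f))"

end

locale banach_vs = normed_vs +
  assumes complete: "mspace.mcomplete"

text \<open>
  A basis \<open>x\<close> together with its coordinate functionals \<open>xs\<close>; these are
  uniquely determined on \<open>V\<close> by \<open>x\<close>. Indices start at 0.
\<close>

locale banach_basis = banach_vs scale V N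
  for scale :: "'f::real_normed_field \<Rightarrow> 'v::ab_group_add \<Rightarrow> 'v"
    and V :: "'v set" and N :: "'v \<Rightarrow> real" +
  fixes x :: "nat \<Rightarrow> 'v" and xs :: "nat \<Rightarrow> 'v \<Rightarrow> 'f"
  assumes basis_in_space: "range x \<subseteq> V"
    and span_dense: "mspace.mtopology closure_of (span (range x)) = V"
    and functionals_in_dual: "range xs \<subseteq> dual"
    and biorthogonal: "xs n (x m) = (if n = m then 1 else 0)"
    and bounded: "bdd_above (range (\<lambda>n. max (N (x n)) (dual_norm (xs n))))"
begin

definition lin_comb :: "(nat \<Rightarrow> 'f) \<Rightarrow> (nat \<Rightarrow> 'v) \<Rightarrow> 'v" where
  "lin_comb a y = (\<Sum>n | a n \<noteq> 0. scale (a n) (y n))"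

definition c00 :: "(nat \<Rightarrow> 'f) set" where
  "c00 = {a. finite {n. a n \<noteq> 0}}"

definition equivalent_to_l1 :: bool where
  "equivalent_to_l1 \<longleftrightarrow>
     (\<exists>C\<ge>1. \<forall>a\<in>c00.
        (1 / C) * (\<Sum>n | a n \<noteq> 0. norm (a n)) \<le> N (lin_comb a x) \<and>
        N (lin_comb a x) \<le> C * (\<Sum>n | a n \<noteq> 0. norm (a n)))"

definition supp :: "'v \<Rightarrow> nat set" where
  "supp f = {n. xs n f \<noteq> 0}"

definition ind :: "(nat \<Rightarrow> 'f) \<Rightarrow> nat set \<Rightarrow> 'v" where
  "ind \<epsilon> A = (\<Sum>n\<in>A. scale (\<epsilon> n) (x n))"

definition dual_ind :: "(nat \<Rightarrow> 'f) \<Rightarrow> nat set \<Rightarrow> 'v \<Rightarrow> 'f" where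
  "dual_ind \<epsilon> A = (\<lambda>f. \<Sum>n\<in>A. \<epsilon> n * xs n f)"

definition coord_proj :: "nat set \<Rightarrow> 'v \<Rightarrow> 'v" where
  "coord_proj A f = (\<Sum>n\<in>A. scale (xs n f) (x n))"

definition property_A :: bool where
  "property_A \<longleftrightarrow>
     (\<forall>f\<in>V. \<forall>A B \<epsilon>.
        (\<forall>n. norm (xs n f) \<le> 1) \<and> finite A \<and> finite B \<and> card A \<le> card B \<and>
        A \<inter> B = {} \<and> A \<inter> supp f = {} \<and> B \<inter> supp f = {} \<and>
        (\<forall>n\<in>A \<union> B. norm (\<epsilon> n) = 1) \<longrightarrow>
        N (ind \<epsilon> A + f) \<le> N (ind \<epsilon> B + f))"

definition suppression_unconditional :: "real \<Rightarrow> bool" where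
  "suppression_unconditional K \<longleftrightarrow>
     (\<forall>A. finite A \<longrightarrow> (\<forall>f\<in>V. N (coord_proj A f) \<le> K * N f))"

definition symmetric :: "real \<Rightarrow> bool" where
  "symmetric C \<longleftrightarrow>
     (\<forall>a\<in>c00. \<forall>\<pi>. bij \<pi> \<longrightarrow> N (lin_comb a x) \<le> C * N (lin_comb a (x \<circ> \<pi>)))"

definition bidemocratic :: "real \<Rightarrow> bool" where
  "bidemocratic C \<longleftrightarrow>
     (\<forall>m A B \<epsilon> \<delta>.
        finite A \<and> finite B \<and> max (card A) (card B) \<le> m \<and>
        (\<forall>n\<in>A. norm (\<epsilon> n) = 1) \<and> (\<forall>n\<in>B. norm (\<delta> n) = 1) \<longrightarrow>
        N (ind \<epsilon> A) * dual_norm (dual_ind \<delta> B) \<le> C * real m)"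

end

end

theory Submission
  imports Defs
begin

text \<open>
  The space is \<open>\<ell>\<^sub>1\<close> with its unit vectors and the norm
  \<open>N(f) = sup\<^sub>D ((\<Sum>n\<in>D. |f n|) + 4 / |D| \<cdot> (\<Sum>n\<in>D. |f n|) + |\<Sum>n\<notin>D. f n|)\<close>,
  where \<open>D\<close> runs over the finite nonempty sets of indices. The first and the third
  summand are together at most the \<open>\<ell>\<^sub>1\<close>-norm; the second is four times the mean of
  \<open>|f|\<close> over \<open>D\<close>. Two effects compete: enlarging \<open>D\<close> removes
  cancellation in the third summand, but including coordinates that are small compared with the
  others lowers the mean. Hence small coordinates outside \<open>D\<close> keep their signs, and
  may cancel each other, whereas coordinates of maximal modulus can always be put into
  \<open>D\<close>, where their signs are lost.

  This is why Property (A) holds (\<open>seminorm_on_exchange\<close>): a set \<open>D\<close> that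
  tests \<open>1\<^sub>A + f\<close> can be replaced by one that contains all of \<open>B\<close>
  and tests \<open>1\<^sub>B + f\<close>; neither the mean nor the total of the first and third
  summands decreases. The cancellation of small coordinates is why suppression
  unconditionality with constant 1 fails: the vector
  \<open>(1, 1/2, -1/2)\<close> has norm at most 5, attained at the peak \<open>D = {0}\<close>,
  and deleting the last coordinate increases the norm by the cancelled \<open>1/2\<close>.

  The norm lies between the \<open>\<ell>\<^sub>1\<close>-norm and five times it, and since the family
  of all \<open>D\<close> is invariant under permutations, the basis is 1-symmetric. Finally,
  \<open>N(1\<^sub>A) \<le> |A| + 4\<close>, while testing with \<open>D = B\<close> shows that the
  norm of \<open>1\<^sup>*\<^sub>B\<close> is at most \<open>|B| / (|B| + 4)\<close>. The two bounds are
  increasing in the size of the sets, and their product is \<open>m\<close> when both sets have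
  \<open>m\<close> elements, so the basis is 1-bidemocratic.

  The argument does not distinguish real from complex scalars and is carried out once for a
  complete normed field.
\<close>

section \<open>The norm on the space of summable sequences\<close>

definition ell1 :: "(nat \<Rightarrow> 'f::{real_normed_field,banach}) set" where
  "ell1 = {f. f abs_summable_on UNIV}"

definition pointwise_scale :: "'f::{real_normed_field,banach} \<Rightarrow> (nat \<Rightarrow> 'f) \<Rightarrow> nat \<Rightarrow> 'f" where
  "pointwise_scale c f = (\<lambda>n. c * f n)"

definition unit_vec :: "nat \<Rightarrow> nat \<Rightarrow> 'f::{real_normed_field,banach}" where
  "unit_vec n = (\<lambda>m. if m = n then 1 else 0)"

definition coord :: "nat \<Rightarrow> (nat \<Rightarrow> 'f::{real_normed_field,banach}) \<Rightarrow> 'f" where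
  "coord n f = f n"

definition l1norm :: "(nat \<Rightarrow> 'f::{real_normed_field,banach}) \<Rightarrow> real" where
  "l1norm f = (\<Sum>\<^sub>\<infinity>n. norm (f n))"

definition seminorm_on :: "nat set \<Rightarrow> (nat \<Rightarrow> 'f::{real_normed_field,banach}) \<Rightarrow> real" where
  "seminorm_on D f =
     (1 + 4 / real (card D)) * (\<Sum>n\<in>D. norm (f n)) + norm (\<Sum>\<^sub>\<infinity>n\<in>- D. f n)"

definition avg_norm :: "(nat \<Rightarrow> 'f::{real_normed_field,banach}) \<Rightarrow> real" where
  "avg_norm f = (SUP D\<in>{D. finite D \<and> D \<noteq> {}}. seminorm_on D f)"

lemma ell1_abs_summable: "f \<in> ell1 \<Longrightarrow> (\<lambda>n. norm (f n)) summable_on S"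
  unfolding ell1_def using summable_on_subset_banach by blast

lemma ell1_summable: "f \<in> ell1 \<Longrightarrow> f summable_on S"
  using ell1_abs_summable abs_summable_summable by blast

lemma ell1_scale: "f \<in> ell1 \<Longrightarrow> pointwise_scale c f \<in> ell1"
  unfolding ell1_def pointwise_scale_def by (auto simp: norm_mult intro: summable_on_cmult_right)

lemma ell1_finite_support:
  assumes "finite A" "\<And>n. n \<notin> A \<Longrightarrow> f n = 0"
  shows "f \<in> ell1"
proof -
  have "(\<lambda>n. norm (f n)) summable_on A"
    using assms by simp
  then have "f abs_summable_on UNIV"
    by (rule summable_on_cong_neutral[THEN iffD1, rotated -1]) (use assms in auto)
  then show ?thesis by (simp add: ell1_def)
qed

lemma ell1_if_sums_bounded:
  assumes "\<And>D. finite D \<Longrightarrow> (\<Sum>n\<in>D. norm (f n)) \<le> K"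
  shows "f \<in> ell1" "l1norm f \<le> K"
proof -
  have "(\<lambda>n. norm (f n)) summable_on UNIV"
    by (rule nonneg_bdd_above_summable_on) (auto intro!: bdd_aboveI2 assms)
  then show "f \<in> ell1" "l1norm f \<le> K"
    by (auto simp: ell1_def l1norm_def intro!: infsum_le_finite_sums assms)
qed

lemma sum_norm_le_l1norm:
  assumes "f \<in> ell1" "finite D"
  shows "(\<Sum>n\<in>D. norm (f n)) \<le> l1norm f"
  unfolding l1norm_def
  by (rule finite_sum_le_infsum) (use assms ell1_abs_summable in auto)

lemma ell1_add:
  assumes "f \<in> ell1" "g \<in> ell1"
  shows "f + g \<in> ell1"
proof (rule ell1_if_sums_bounded(1))
  fix D :: "nat set" assume D: "finite D"
  have "(\<Sum>n\<in>D. norm ((f + g) n)) \<le> (\<Sum>n\<in>D. norm (f n)) + (\<Sum>n\<in>D. norm (g n))"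
    by (simp add: norm_triangle_ineq sum.distrib[symmetric] sum_mono)
  also have "\<dots> \<le> l1norm f + l1norm g"
    using D assms by (intro add_mono sum_norm_le_l1norm)
  finally show "(\<Sum>n\<in>D. norm ((f + g) n)) \<le> l1norm f + l1norm g" .
qed

text \<open>
  Discarding the cancellation outside \<open>D\<close> leaves the \<open>\<ell>\<^sub>1\<close>-norm and
  the mean; all bounds of the norm by the \<open>\<ell>\<^sub>1\<close>-norm come from here.
\<close>

lemma seminorm_on_le_mean:
  assumes "f \<in> ell1" "finite D"
  shows "seminorm_on D f \<le> l1norm f + 4 * ((\<Sum>n\<in>D. norm (f n)) / real (card D))"
proof -
  have "norm (\<Sum>\<^sub>\<infinity>n\<in>-D. f n) \<le> (\<Sum>\<^sub>\<infinity>n\<in>-D. norm (f n))"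
    by (rule norm_infsum_bound) (use assms ell1_abs_summable in auto)
  moreover have "l1norm f = (\<Sum>\<^sub>\<infinity>n\<in>D \<union> -D. norm (f n))"
    by (simp add: l1norm_def Compl_partition)
  moreover have "\<dots> = (\<Sum>n\<in>D. norm (f n)) + (\<Sum>\<^sub>\<infinity>n\<in>-D. norm (f n))"
    by (subst infsum_Un_disjoint) (use assms ell1_abs_summable in auto)
  ultimately show ?thesis
    by (simp add: seminorm_on_def algebra_simps)
qed

lemma mean_le_bound:
  assumes "\<And>n. norm (f n) \<le> M" "finite D" "D \<noteq> {}"
  shows "(\<Sum>n\<in>D. norm (f n)) / real (card D) \<le> M"
proof -
  have "(\<Sum>n\<in>D. norm (f n)) \<le> real (card D) * M"
    using sum_bounded_above[of D "\<lambda>n. norm (f n)" M] assms by simp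
  then show ?thesis
    using assms by (simp add: divide_le_eq card_gt_0_iff mult.commute)
qed

lemma seminorm_on_le_bound:
  assumes "f \<in> ell1" "\<And>n. norm (f n) \<le> M" "finite D" "D \<noteq> {}"
  shows "seminorm_on D f \<le> l1norm f + 4 * M"
  using seminorm_on_le_mean[of f D] mean_le_bound[of f M D] assms by simp

lemma norm_coord_le_l1norm: "f \<in> ell1 \<Longrightarrow> norm (f n) \<le> l1norm f"
  using sum_norm_le_l1norm[of f "{n}"] by simp

lemma l1norm_nonneg: "0 \<le> l1norm f"
  unfolding l1norm_def by (simp add: infsum_nonneg)

lemma bdd_above_seminorms:
  "f \<in> ell1 \<Longrightarrow> bdd_above ((\<lambda>D. seminorm_on D f) ` {D. finite D \<and> D \<noteq> {}})"
  by (rule bdd_aboveI2[where M = "l1norm f + 4 * l1norm f"], rule seminorm_on_le_bound)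
     (auto intro: norm_coord_le_l1norm)

lemma seminorm_le_avg_norm:
  "f \<in> ell1 \<Longrightarrow> finite D \<Longrightarrow> D \<noteq> {} \<Longrightarrow> seminorm_on D f \<le> avg_norm f"
  unfolding avg_norm_def by (rule cSUP_upper) (auto intro: bdd_above_seminorms)

lemma avg_norm_least:
  "(\<And>D. finite D \<Longrightarrow> D \<noteq> {} \<Longrightarrow> seminorm_on D f \<le> K) \<Longrightarrow> avg_norm f \<le> K"
  unfolding avg_norm_def by (rule cSUP_least) auto

lemma avg_norm_le_bound:
  assumes "f \<in> ell1" "\<And>n. norm (f n) \<le> M"
  shows "avg_norm f \<le> l1norm f + 4 * M"
  by (rule avg_norm_least) (use assms in \<open>auto intro: seminorm_on_le_bound\<close>)

lemma avg_norm_le_l1norm: "f \<in> ell1 \<Longrightarrow> avg_norm f \<le> 5 * l1norm f"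
  using avg_norm_le_bound[of f "l1norm f"] norm_coord_le_l1norm[of f] by simp

text \<open>
  The factor \<open>1 + 4 / card D\<close> is what later makes the dual norm of the indicator
  functionals small enough for bidemocracy.
\<close>

lemma sum_norm_le_avg_norm:
  assumes "f \<in> ell1" "finite D" "D \<noteq> {}"
  shows "(1 + 4 / real (card D)) * (\<Sum>n\<in>D. norm (f n)) \<le> avg_norm f"
proof -
  have "(1 + 4 / real (card D)) * (\<Sum>n\<in>D. norm (f n)) \<le> seminorm_on D f"
    by (simp add: seminorm_on_def)
  then show ?thesis
    using seminorm_le_avg_norm[OF assms] by simp
qed

lemma l1norm_le_avg_norm:
  assumes "f \<in> ell1"
  shows "l1norm f \<le> avg_norm f"
proof (rule ell1_if_sums_bounded(2))
  fix D :: "nat set" assume D: "finite D"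
  have "(\<Sum>n\<in>D. norm (f n)) \<le> (\<Sum>n\<in>insert 0 D. norm (f n))"
    using D by (intro sum_mono2) auto
  also have "\<dots> \<le> (1 + 4 / real (card (insert 0 D))) * (\<Sum>n\<in>insert 0 D. norm (f n))"
    by (simp add: distrib_right sum_nonneg)
  also have "\<dots> \<le> avg_norm f"
    using sum_norm_le_avg_norm[of f "insert 0 D"] assms D by blast
  finally show "(\<Sum>n\<in>D. norm (f n)) \<le> avg_norm f" .
qed

lemma seminorm_on_add:
  assumes "f \<in> ell1" "g \<in> ell1"
  shows "seminorm_on D (f + g) \<le> seminorm_on D f + seminorm_on D g"
proof -
  have "(\<Sum>n\<in>D. norm (f n + g n)) \<le> (\<Sum>n\<in>D. norm (f n)) + (\<Sum>n\<in>D. norm (g n))"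
    by (simp add: norm_triangle_ineq sum.distrib[symmetric] sum_mono)
  then have "(1 + 4 / real (card D)) * (\<Sum>n\<in>D. norm (f n + g n))
      \<le> (1 + 4 / real (card D)) * ((\<Sum>n\<in>D. norm (f n)) + (\<Sum>n\<in>D. norm (g n)))"
    by (rule mult_left_mono) simp
  moreover have "(\<Sum>\<^sub>\<infinity>n\<in>-D. f n + g n) = (\<Sum>\<^sub>\<infinity>n\<in>-D. f n) + (\<Sum>\<^sub>\<infinity>n\<in>-D. g n)"
    by (rule infsum_add) (use assms ell1_summable in auto)
  ultimately show ?thesis
    using norm_triangle_ineq[of "\<Sum>\<^sub>\<infinity>n\<in>-D. f n" "\<Sum>\<^sub>\<infinity>n\<in>-D. g n"]
    by (simp add: seminorm_on_def distrib_left)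
qed

lemma seminorm_on_scale:
  "seminorm_on D (pointwise_scale c f) = norm c * seminorm_on D f"
  by (simp add: seminorm_on_def pointwise_scale_def norm_mult infsum_cmult_right'
      sum_distrib_left[symmetric] algebra_simps)

lemma avg_norm_add:
  assumes "f \<in> ell1" "g \<in> ell1"
  shows "avg_norm (f + g) \<le> avg_norm f + avg_norm g"
  by (rule avg_norm_least)
     (use assms in \<open>auto intro: order_trans[OF seminorm_on_add add_mono] seminorm_le_avg_norm\<close>)

lemma avg_norm_scale_le:
  assumes "f \<in> ell1"
  shows "avg_norm (pointwise_scale c f) \<le> norm c * avg_norm f"
  by (rule avg_norm_least)
     (auto simp: seminorm_on_scale intro!: mult_left_mono seminorm_le_avg_norm assms)

lemma avg_norm_scale:
  assumes "f \<in> ell1"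
  shows "avg_norm (pointwise_scale c f) = norm c * avg_norm f"
proof (cases "c = 0")
  case True
  have "avg_norm (pointwise_scale c f) = 0"
    using True by (simp add: avg_norm_def seminorm_on_scale)
      (rule cSUP_const, auto)
  then show ?thesis using True by simp
next
  case False
  have "pointwise_scale (inverse c) (pointwise_scale c f) = f"
    using False by (simp add: pointwise_scale_def fun_eq_iff)
  then have "avg_norm f \<le> norm (inverse c) * avg_norm (pointwise_scale c f)"
    using avg_norm_scale_le[of "pointwise_scale c f" "inverse c"] ell1_scale[OF assms, of c]
    by simp
  then have "norm c * avg_norm f \<le> avg_norm (pointwise_scale c f)"
    using False by (simp add: norm_inverse pos_le_divide_eq divide_inverse_commute[symmetric]
        mult.commute)
  then show ?thesis
    using avg_norm_scale_le[OF assms, of c] by simp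
qed

lemma avg_norm_eq_0:
  assumes "f \<in> ell1"
  shows "avg_norm f = 0 \<longleftrightarrow> f = 0"
proof
  assume "avg_norm f = 0"
  then have "norm (f n) \<le> 0" for n
    using norm_coord_le_l1norm[OF assms, of n] l1norm_le_avg_norm[OF assms] by linarith
  then have "f n = 0" for n
    by simp
  then show "f = 0" by (simp add: fun_eq_iff)
next
  assume "f = 0"
  then show "avg_norm f = 0"
    using avg_norm_scale[OF assms, of 0] by (simp add: pointwise_scale_def zero_fun_def)
qed

interpretation seq: vector_space
  "pointwise_scale :: 'f::{real_normed_field,banach} \<Rightarrow> (nat \<Rightarrow> 'f) \<Rightarrow> nat \<Rightarrow> 'f"
  by unfold_locales (auto simp: pointwise_scale_def fun_eq_iff algebra_simps)

interpretation ell1: normed_vs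
  "pointwise_scale :: 'f::{real_normed_field,banach} \<Rightarrow> (nat \<Rightarrow> 'f) \<Rightarrow> nat \<Rightarrow> 'f" ell1 avg_norm
proof
  show "seq.subspace ell1"
    by (rule seq.subspaceI) (auto intro: ell1_add ell1_scale ell1_finite_support[of "{}"])
qed (auto simp: avg_norm_eq_0 avg_norm_scale avg_norm_add)

lemma ell1_diff: "f \<in> ell1 \<Longrightarrow> g \<in> ell1 \<Longrightarrow> f - g \<in> ell1"
  using ell1.carrier_subspace seq.subspace_diff by blast


section \<open>Completeness and the unit vector basis\<close>

text \<open>
  The norm dominates every finite sum of moduli of coordinates. So a Cauchy sequence converges
  in each coordinate, the finite sums pass to the limit with the same bounds, and these bounds
  control the norm because it is at most five times the \<open>\<ell>\<^sub>1\<close>-norm.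
\<close>

lemma ell1_cauchy_converges:
  fixes s :: "nat \<Rightarrow> nat \<Rightarrow> 'f::{real_normed_field,banach}"
  assumes s: "\<And>k. s k \<in> ell1"
    and cauchy: "\<And>e. e > 0 \<Longrightarrow> \<exists>M. \<forall>j\<ge>M. \<forall>k\<ge>M. avg_norm (s j - s k) < e"
  obtains f where "f \<in> ell1" "\<And>e. e > 0 \<Longrightarrow> \<exists>M. \<forall>k\<ge>M. avg_norm (s k - f) < e"
proof -
  have sums: "(\<Sum>n\<in>D. norm (s j n - s k n)) \<le> avg_norm (s j - s k)" if "finite D" for D j k
    using order_trans[OF sum_norm_le_l1norm l1norm_le_avg_norm, of "s j - s k" D] ell1_diff s that
    by auto
  have "Cauchy (\<lambda>k. s k n)" for n
  proof (rule metric_CauchyI)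
    fix e :: real assume "e > 0"
    then obtain M where M: "\<forall>j\<ge>M. \<forall>k\<ge>M. avg_norm (s j - s k) < e"
      using cauchy by blast
    have "dist (s j n) (s k n) < e" if "j \<ge> M" "k \<ge> M" for j k
      using sums[of "{n}" j k] M[rule_format, OF that] by (simp add: dist_norm)
    then show "\<exists>M. \<forall>j\<ge>M. \<forall>k\<ge>M. dist (s j n) (s k n) < e"
      by blast
  qed
  then have "\<forall>n. \<exists>l. (\<lambda>k. s k n) \<longlonglongrightarrow> l"
    using Cauchy_convergent_iff convergent_def by blast
  then obtain f where f: "\<And>n. (\<lambda>k. s k n) \<longlonglongrightarrow> f n"
    by metis
  have close: "\<exists>M. \<forall>k\<ge>M. s k - f \<in> ell1 \<and> l1norm (s k - f) \<le> e" if e: "e > 0" for e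
  proof -
    obtain M where M: "\<forall>j\<ge>M. \<forall>k\<ge>M. avg_norm (s j - s k) < e"
      using cauchy e by blast
    have "(\<Sum>n\<in>D. norm ((s k - f) n)) \<le> e" if k: "k \<ge> M" and D: "finite D" for k D
    proof -
      have "(\<lambda>j. \<Sum>n\<in>D. norm (s k n - s j n)) \<longlonglongrightarrow> (\<Sum>n\<in>D. norm (s k n - f n))"
        by (intro tendsto_intros f)
      moreover have "(\<Sum>n\<in>D. norm (s k n - s j n)) \<le> e" if "j \<ge> M" for j
        using sums[OF D, of k j] M[rule_format, OF k that] by simp
      ultimately have "(\<Sum>n\<in>D. norm (s k n - f n)) \<le> e"
        using LIMSEQ_le_const2 by blast
      then show ?thesis by simp
    qed
    then show ?thesis
      by (intro exI[of _ M] allI impI conjI ell1_if_sums_bounded) auto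
  qed
  show thesis
  proof
    obtain k where "s k - f \<in> ell1"
      using close[of 1] by auto
    then show "f \<in> ell1"
      using ell1_diff[OF s[of k], of "s k - f"] by simp
    fix e :: real assume "e > 0"
    \<comment> \<open>A sixth of \<open>e\<close>, for a strict inequality after multiplication by 5.\<close>
    then obtain M where M: "\<forall>k\<ge>M. s k - f \<in> ell1 \<and> l1norm (s k - f) \<le> e / 6"
      using close[of "e / 6"] by auto
    have "avg_norm (s k - f) < e" if "k \<ge> M" for k
      using avg_norm_le_l1norm[of "s k - f"] M that \<open>e > 0\<close> by fastforce
    then show "\<exists>M. \<forall>k\<ge>M. avg_norm (s k - f) < e"
      by blast
  qed
qed

interpretation ell1: banach_vs
  "pointwise_scale :: 'f::{real_normed_field,banach} \<Rightarrow> (nat \<Rightarrow> 'f) \<Rightarrow> nat \<Rightarrow> 'f" ell1 avg_norm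
proof
  show "Metric_space.mcomplete (ell1 :: (nat \<Rightarrow> 'f) set) (normed_vs.ndist ell1 avg_norm)"
    unfolding ell1.mspace.mcomplete_def
  proof (intro allI impI)
    fix s :: "nat \<Rightarrow> nat \<Rightarrow> 'f"
    assume C: "ell1.mspace.MCauchy s"
    then have s: "s k \<in> ell1" for k
      by (auto simp: ell1.mspace.MCauchy_def)
    have "\<exists>M. \<forall>j\<ge>M. \<forall>k\<ge>M. avg_norm (s j - s k) < e" if "e > 0" for e
      using C that s by (simp add: ell1.mspace.MCauchy_def ell1.ndist_def)
    then obtain f where f: "f \<in> ell1" "\<And>e. e > 0 \<Longrightarrow> \<exists>M. \<forall>k\<ge>M. avg_norm (s k - f) < e"
      using ell1_cauchy_converges[of s] s by blast
    then show "\<exists>f. limitin ell1.mspace.mtopology s f sequentially"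
      using s by (auto simp: ell1.mspace.limitin_metric ell1.ndist_def eventually_sequentially
          intro!: exI[of _ f])
  qed
qed

lemma finite_combination:
  assumes "finite A"
  shows "(\<Sum>n\<in>A. pointwise_scale (a n) (unit_vec n)) = (\<lambda>m. if m \<in> A then a m else 0)"
proof
  have pt: "(\<Sum>n\<in>A. g n) m = (\<Sum>n\<in>A. g n m)" for g :: "nat \<Rightarrow> nat \<Rightarrow> 'a" and m
    using assms by induction auto
  fix m
  show "(\<Sum>n\<in>A. pointwise_scale (a n) (unit_vec n)) m = (if m \<in> A then a m else 0)"
    using assms by (simp add: pt pointwise_scale_def unit_vec_def if_distrib cong: if_cong)
qed

lemma unit_vec_in_ell1: "unit_vec n \<in> ell1"
  by (rule ell1_finite_support[of "{n}"]) (auto simp: unit_vec_def)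

lemma l1norm_finite_support:
  assumes "finite A" "\<And>n. n \<notin> A \<Longrightarrow> f n = 0"
  shows "l1norm f = (\<Sum>n\<in>A. norm (f n))"
proof -
  have "l1norm f = (\<Sum>\<^sub>\<infinity>n\<in>A. norm (f n))"
    unfolding l1norm_def by (rule infsum_cong_neutral) (use assms in auto)
  then show ?thesis
    using assms by simp
qed

lemma finite_support_dense:
  assumes f: "f \<in> ell1" and e: "e > 0"
  obtains A where "finite A" "avg_norm (f - (\<lambda>m. if m \<in> A then f m else 0)) < e"
proof -
  have "\<exists>A. finite A \<and> A \<subseteq> UNIV \<and>
      dist (\<Sum>n\<in>A. norm (f n)) (l1norm f) \<le> e / 6"
    using infsum_finite_approximation[of "\<lambda>n. norm (f n)" UNIV "e / 6"] ell1_abs_summable[OF f] e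
    unfolding l1norm_def by auto
  then obtain A where A: "finite A" and "dist (\<Sum>n\<in>A. norm (f n)) (l1norm f) \<le> e / 6"
    by blast
  then have lo: "l1norm f \<le> (\<Sum>n\<in>A. norm (f n)) + e / 6"
    unfolding dist_real_def by linarith
  define r where "r = f - (\<lambda>m. if m \<in> A then f m else 0)"
  have r: "(\<Sum>n\<in>D. norm (r n)) \<le> e / 6" if D: "finite D" for D
  proof -
    have "(\<Sum>n\<in>D. norm (r n)) = (\<Sum>n\<in>D - A. norm (f n))"
      by (rule sum.mono_neutral_cong_right) (auto simp: r_def D)
    moreover have "(\<Sum>n\<in>D - A. norm (f n)) + (\<Sum>n\<in>A. norm (f n)) = (\<Sum>n\<in>(D - A) \<union> A. norm (f n))"
      by (rule sum.union_disjoint[symmetric]) (auto simp: A D)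
    moreover have "\<dots> \<le> l1norm f"
      by (rule sum_norm_le_l1norm) (auto simp: A D f)
    ultimately show ?thesis using lo by linarith
  qed
  have "avg_norm r \<le> 5 * l1norm r" "l1norm r \<le> e / 6"
    using ell1_if_sums_bounded[OF r] avg_norm_le_l1norm by auto
  then have "avg_norm r < e" using e by linarith
  then show thesis
    using that A by (simp add: r_def)
qed

lemma coord_in_dual: "coord n \<in> ell1.dual"
proof -
  have "norm (f n) \<le> 1 * avg_norm f" if "f \<in> ell1" for f :: "nat \<Rightarrow> 'a"
    using norm_coord_le_l1norm[OF that, of n] l1norm_le_avg_norm[OF that] by simp
  then show ?thesis
    unfolding ell1.dual_def by (auto simp: coord_def pointwise_scale_def intro!: exI[of _ 1])
qed

lemma dual_norm_le:
  fixes \<phi> :: "(nat \<Rightarrow> 'f::{real_normed_field,banach}) \<Rightarrow> 'f"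
  assumes "\<And>f. f \<in> ell1 \<Longrightarrow> norm (\<phi> f) \<le> K * avg_norm f" "0 \<le> K"
  shows "ell1.dual_norm \<phi> \<le> K"
  unfolding ell1.dual_norm_def
proof (rule cSUP_least)
  have "(0 :: nat \<Rightarrow> 'f) \<in> ell1" "avg_norm (0 :: nat \<Rightarrow> 'f) = 0"
    using ell1.carrier_subspace seq.subspace_0 avg_norm_eq_0 by blast+
  then show "{f \<in> ell1. avg_norm (f :: nat \<Rightarrow> 'f) \<le> 1} \<noteq> {}"
    by (intro notI) (auto dest: equals0D[of _ "0 :: nat \<Rightarrow> 'f"])
  fix f :: "nat \<Rightarrow> 'f" assume "f \<in> {f \<in> ell1. avg_norm f \<le> 1}"
  then show "norm (\<phi> f) \<le> K"
    using assms(1)[of f] mult_left_le[of "avg_norm f" K] assms(2) by auto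
qed

interpretation ell1: banach_basis
  "pointwise_scale :: 'f::{real_normed_field,banach} \<Rightarrow> (nat \<Rightarrow> 'f) \<Rightarrow> nat \<Rightarrow> 'f" ell1 avg_norm
  unit_vec coord
proof
  show "range (unit_vec :: nat \<Rightarrow> nat \<Rightarrow> 'f) \<subseteq> ell1"
    using unit_vec_in_ell1 by auto
  show "range (coord :: nat \<Rightarrow> (nat \<Rightarrow> 'f) \<Rightarrow> 'f) \<subseteq> ell1.dual"
    using coord_in_dual by auto
  show "coord n (unit_vec m :: nat \<Rightarrow> 'f) = (if n = m then 1 else 0)" for n m
    by (simp add: coord_def unit_vec_def)
  have "avg_norm (unit_vec n :: nat \<Rightarrow> 'f) \<le> 5" for n
    using avg_norm_le_l1norm[OF unit_vec_in_ell1[of n, where 'a = 'f]]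
      l1norm_finite_support[of "{n}" "unit_vec n :: nat \<Rightarrow> 'f"]
    by (simp add: unit_vec_def)
  moreover have "ell1.dual_norm (coord n :: (nat \<Rightarrow> 'f) \<Rightarrow> 'f) \<le> 1" for n
    using norm_coord_le_l1norm l1norm_le_avg_norm
    by (intro dual_norm_le) (auto simp: coord_def intro: order_trans)
  ultimately have "max (avg_norm (unit_vec n :: nat \<Rightarrow> 'f))
      (ell1.dual_norm (coord n :: (nat \<Rightarrow> 'f) \<Rightarrow> 'f)) \<le> 5" for n
    by (smt (verit))
  then show "bdd_above (range (\<lambda>n. max (avg_norm (unit_vec n :: nat \<Rightarrow> 'f))
      (ell1.dual_norm (coord n :: (nat \<Rightarrow> 'f) \<Rightarrow> 'f))))"
    by (intro bdd_aboveI2) auto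
  show "ell1.mspace.mtopology closure_of seq.span (range (unit_vec :: nat \<Rightarrow> nat \<Rightarrow> 'f)) = ell1"
  proof
    show "ell1.mspace.mtopology closure_of seq.span (range (unit_vec :: nat \<Rightarrow> nat \<Rightarrow> 'f)) \<subseteq> ell1"
      using closure_of_subset_topspace by fastforce
    have "\<exists>g\<in>seq.span (range unit_vec). g \<in> ell1 \<and> avg_norm (f - g) < e"
      if f: "f \<in> ell1" and e: "e > 0" for f :: "nat \<Rightarrow> 'f" and e
    proof -
      obtain A where A: "finite A" "avg_norm (f - (\<lambda>m. if m \<in> A then f m else 0)) < e"
        using finite_support_dense[OF f e] by blast
      show ?thesis
      proof (rule bexI[of _ "\<lambda>m. if m \<in> A then f m else 0"], intro conjI)
        show "(\<lambda>m. if m \<in> A then f m else 0) \<in> seq.span (range unit_vec)"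
          unfolding finite_combination[OF A(1), symmetric]
          by (intro seq.span_sum seq.span_scale seq.span_base) auto
        show "(\<lambda>m. if m \<in> A then f m else 0) \<in> ell1"
          using A(1) by (intro ell1_finite_support[of A]) auto
      qed (rule A(2))
    qed
    then show "ell1 \<subseteq> ell1.mspace.mtopology closure_of seq.span (range (unit_vec :: nat \<Rightarrow> nat \<Rightarrow> 'f))"
      by (auto simp: ell1.mspace.metric_closure_of ell1.mspace.in_mball ell1.ndist_def)
  qed
qed

lemma lin_comb_eq:
  "a \<in> ell1.c00 \<Longrightarrow> ell1.lin_comb a unit_vec = a"
  unfolding ell1.lin_comb_def ell1.c00_def by (subst finite_combination) (auto simp: fun_eq_iff)

lemma c00_in_ell1: "a \<in> ell1.c00 \<Longrightarrow> a \<in> ell1"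
  unfolding ell1.c00_def by (auto intro: ell1_finite_support)

lemma ind_eq: "finite A \<Longrightarrow> ell1.ind \<epsilon> A = (\<lambda>m. if m \<in> A then \<epsilon> m else 0)"
  unfolding ell1.ind_def by (rule finite_combination)

section \<open>Equivalence to the \<open>\<ell>\<^sub>1\<close>-basis and symmetry\<close>

lemma avg_norm_equivalent_to_l1:
  "banach_basis.equivalent_to_l1 (pointwise_scale :: 'f::{real_normed_field,banach} \<Rightarrow> _) avg_norm unit_vec"
  unfolding ell1.equivalent_to_l1_def
proof (intro exI[of _ 5] conjI ballI)
  fix a :: "nat \<Rightarrow> 'f" assume a: "a \<in> ell1.c00"
  have "l1norm a = (\<Sum>n | a n \<noteq> 0. norm (a n))"
    using a by (intro l1norm_finite_support) (auto simp: ell1.c00_def)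
  then show "1 / 5 * (\<Sum>n | a n \<noteq> 0. norm (a n)) \<le> avg_norm (ell1.lin_comb a unit_vec)"
    "avg_norm (ell1.lin_comb a unit_vec) \<le> 5 * (\<Sum>n | a n \<noteq> 0. norm (a n))"
    using a l1norm_le_avg_norm[of a] avg_norm_le_l1norm[of a] l1norm_nonneg[of a]
    by (auto simp: lin_comb_eq c00_in_ell1)
qed simp

lemma seminorm_on_reindex:
  assumes "bij \<pi>"
  shows "seminorm_on D (f \<circ> \<pi>) = seminorm_on (\<pi> ` D) f"
proof -
  have inj: "inj_on \<pi> D"
    using assms bij_is_inj inj_on_subset by blast
  have "bij_betw \<pi> (- D) (- (\<pi> ` D))"
    using assms by (metis bij_betw_subset bij_image_Compl_eq subset_UNIV)
  then have "(\<Sum>\<^sub>\<infinity>n\<in>- D. f (\<pi> n)) = (\<Sum>\<^sub>\<infinity>n\<in>- (\<pi> ` D). f n)"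
    by (rule infsum_reindex_bij_betw)
  then show ?thesis
    by (simp add: seminorm_on_def card_image[OF inj] sum.reindex[OF inj])
qed

lemma avg_norm_le_reindex:
  assumes "bij \<pi>" "f \<circ> \<pi> \<in> ell1"
  shows "avg_norm f \<le> avg_norm (f \<circ> \<pi>)"
proof (rule avg_norm_least)
  fix D :: "nat set" assume D: "finite D" "D \<noteq> {}"
  have "\<pi> ` (inv \<pi> ` D) = D"
    using assms by (simp add: bij_is_surj image_f_inv_f)
  then have "seminorm_on D f = seminorm_on (inv \<pi> ` D) (f \<circ> \<pi>)"
    using seminorm_on_reindex[OF assms(1), of "inv \<pi> ` D" f] by simp
  also have "\<dots> \<le> avg_norm (f \<circ> \<pi>)"
    using seminorm_le_avg_norm[OF assms(2)] D by simp
  finally show "seminorm_on D f \<le> avg_norm (f \<circ> \<pi>)" .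
qed

lemma avg_norm_symmetric:
  "banach_basis.symmetric (pointwise_scale :: 'f::{real_normed_field,banach} \<Rightarrow> _) avg_norm unit_vec 1"
  unfolding ell1.symmetric_def
proof (intro ballI allI impI)
  fix a :: "nat \<Rightarrow> 'f" and \<pi> :: "nat \<Rightarrow> nat"
  assume a: "a \<in> ell1.c00" and \<pi>: "bij \<pi>"
  define \<rho> where "\<rho> = inv \<pi>"
  have \<rho>: "bij \<rho>" and inv: "\<rho> (\<pi> n) = n" "\<pi> (\<rho> n) = n" for n
    using \<pi> by (auto simp: \<rho>_def bij_imp_bij_inv bij_is_inj bij_is_surj surj_f_inv_f)
  let ?S = "{n. a n \<noteq> 0}"
  have fin: "finite ?S" using a by (simp add: ell1.c00_def)
  have "inj_on \<pi> ?S"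
    using \<pi> bij_is_inj inj_on_subset by blast
  then have "ell1.lin_comb a (unit_vec \<circ> \<pi>)
      = (\<Sum>n\<in>\<pi> ` ?S. pointwise_scale ((a \<circ> \<rho>) n) (unit_vec n))"
    by (simp add: ell1.lin_comb_def sum.reindex inv)
  also have "\<dots> = (\<lambda>m. if m \<in> \<pi> ` ?S then (a \<circ> \<rho>) m else 0)"
    using fin by (intro finite_combination) simp
  also have "\<dots> = a \<circ> \<rho>"
    by (auto simp: fun_eq_iff) (metis (mono_tags) imageI inv(2) mem_Collect_eq)
  finally have comb: "ell1.lin_comb a (unit_vec \<circ> \<pi>) = a \<circ> \<rho>" .
  have "a \<circ> \<rho> \<in> ell1"
    using fin by (intro ell1_finite_support[of "\<pi> ` ?S"])
      (auto, metis (mono_tags) imageI inv(2) mem_Collect_eq)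
  then show "avg_norm (ell1.lin_comb a unit_vec) \<le> 1 * avg_norm (ell1.lin_comb a (unit_vec \<circ> \<pi>))"
    using avg_norm_le_reindex[OF \<rho>] by (simp add: comb lin_comb_eq[OF a])
qed

section \<open>Bidemocracy\<close>

lemma avg_norm_signs:
  assumes "finite A" "A \<noteq> {}" "\<And>n. n \<in> A \<Longrightarrow> norm (\<epsilon> n) = 1"
  shows "avg_norm (\<lambda>m. if m \<in> A then \<epsilon> m else 0) \<le> real (card A) + 4"
proof -
  let ?f = "\<lambda>m. if m \<in> A then \<epsilon> m else 0"
  have "?f \<in> ell1"
    using assms by (auto intro: ell1_finite_support[of A])
  moreover have "l1norm ?f = (\<Sum>n\<in>A. norm (?f n))"
    using assms by (intro l1norm_finite_support) auto
  ultimately show ?thesis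
    using avg_norm_le_bound[of ?f 1] assms by simp
qed

text \<open>
  The functional is at most \<open>\<Sum>n\<in>B. norm (f n)\<close>, and the seminorm with
  \<open>D = B\<close> is at least \<open>1 + 4 / card B\<close> times that sum.
\<close>

lemma dual_norm_signs:
  fixes \<delta> :: "nat \<Rightarrow> 'f::{real_normed_field,banach}"
  assumes "finite B" "\<And>n. n \<in> B \<Longrightarrow> norm (\<delta> n) = 1"
  shows "ell1.dual_norm (ell1.dual_ind \<delta> B) \<le> real (card B) / (real (card B) + 4)"
proof (rule dual_norm_le)
  fix f :: "nat \<Rightarrow> 'f" assume f: "f \<in> ell1"
  show "norm (ell1.dual_ind \<delta> B f) \<le> real (card B) / (real (card B) + 4) * avg_norm f"
  proof (cases "B = {}")
    case False
    then have c: "real (card B) > 0"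
      using assms by (simp add: card_gt_0_iff)
    have le: "norm (ell1.dual_ind \<delta> B f) \<le> (\<Sum>n\<in>B. norm (f n))"
      unfolding ell1.dual_ind_def
      by (rule sum_norm_le) (simp add: coord_def norm_mult assms)
    have "(real (card B) + 4) / real (card B) * (\<Sum>n\<in>B. norm (f n)) \<le> avg_norm f"
      using sum_norm_le_avg_norm[OF f assms(1) False] c by (simp add: add_divide_distrib)
    then have "(\<Sum>n\<in>B. norm (f n)) \<le> real (card B) / (real (card B) + 4) * avg_norm f"
      using c by (simp add: field_simps)
    then show ?thesis
      using le by linarith
  qed (simp add: ell1.dual_ind_def)
qed simp

lemma avg_norm_bidemocratic:
  "banach_basis.bidemocratic (pointwise_scale :: 'f::{real_normed_field,banach} \<Rightarrow> _)
     ell1 avg_norm unit_vec coord 1"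
  unfolding ell1.bidemocratic_def
proof (intro allI impI, elim conjE)
  fix m A B and \<epsilon> \<delta> :: "nat \<Rightarrow> 'f"
  assume A: "finite A" "\<forall>n\<in>A. norm (\<epsilon> n) = 1" and B: "finite B" "\<forall>n\<in>B. norm (\<delta> n) = 1"
    and m: "max (card A) (card B) \<le> m"
  show "avg_norm (ell1.ind \<epsilon> A) * ell1.dual_norm (ell1.dual_ind \<delta> B) \<le> 1 * real m"
  proof (cases "A = {}")
    case True
    then have "avg_norm (ell1.ind \<epsilon> A) = 0"
      by (simp add: ell1.ind_def avg_norm_eq_0 ell1_finite_support[of "{}"])
    then show ?thesis by simp
  next
    case False
    have "avg_norm (ell1.ind \<epsilon> A) \<le> real (card A) + 4"
      using avg_norm_signs[OF A(1) False, of \<epsilon>] A by (simp add: ind_eq)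
    then have le1: "avg_norm (ell1.ind \<epsilon> A) \<le> real m + 4"
      using m by simp
    have "ell1.dual_norm (ell1.dual_ind \<delta> B) \<le> real (card B) / (real (card B) + 4)"
      using dual_norm_signs B by blast
    also have "\<dots> \<le> real m / (real m + 4)"
      using m by (simp add: field_simps)
    finally have le2: "ell1.dual_norm (ell1.dual_ind \<delta> B) \<le> real m / (real m + 4)" .
    have "0 \<le> avg_norm (ell1.ind \<epsilon> A)"
      using A(1) by (intro ell1.norm_nonneg) (auto simp: ind_eq intro: ell1_finite_support[of A])
    then have "avg_norm (ell1.ind \<epsilon> A) * ell1.dual_norm (ell1.dual_ind \<delta> B)
        \<le> avg_norm (ell1.ind \<epsilon> A) * (real m / (real m + 4))"
      by (rule mult_left_mono[OF le2])
    also have "\<dots> \<le> (real m + 4) * (real m / (real m + 4))"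
      by (rule mult_right_mono[OF le1]) simp
    finally show ?thesis by simp
  qed
qed

section \<open>Property (A)\<close>

text \<open>
  Here \<open>s\<close> is a sum of \<open>e\<close> numbers in the unit interval. Replacing
  \<open>a\<close> further entries 1 by at least as many, \<open>b\<close> of them, does not lower the
  mean, and neither does dropping \<open>c\<close> entries 0.
\<close>

lemma mean_mono:
  fixes s e a b c :: real
  assumes "0 \<le> s" "s \<le> e" "0 \<le> a" "a \<le> b" "0 \<le> c"
  shows "(s + a) / (e + a + c) \<le> (s + b) / (e + b)"
proof (cases "e + a > 0")
  case True
  have "(s + a) / (e + a + c) \<le> (s + a) / (e + a)"
    using assms True by (intro divide_left_mono) auto
  also have "\<dots> \<le> (s + b) / (e + b)"
  proof -
    have "0 \<le> (b - a) * (e - s)"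
      using assms by simp
    then show ?thesis
      using assms True by (simp add: field_simps)
  qed
  finally show ?thesis .
next
  case False
  then have "s = 0" "a = 0" using assms by linarith+
  then show ?thesis using assms by simp
qed

text \<open>
  The indices of \<open>A\<close> and \<open>B\<close> are removed from \<open>D\<close> and all of
  \<open>B\<close> is added. The contribution of the signs on \<open>A\<close>, inside and outside
  \<open>D\<close>, is at most \<open>card A\<close>, and it is replaced by \<open>card B\<close>. The
  sum of \<open>f\<close> outside \<open>D\<close> stays the same, since \<open>f\<close> vanishes on
  \<open>A\<close> and \<open>B\<close>. The mean does not drop because the new entries 1 are
  maximal.
\<close>

lemma seminorm_on_exchange:
  fixes f :: "nat \<Rightarrow> 'f::{real_normed_field,banach}"
  assumes f: "f \<in> ell1" "\<And>n. norm (f n) \<le> 1" "\<And>n. n \<in> A \<union> B \<Longrightarrow> f n = 0"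
    and AB: "finite A" "finite B" "card A \<le> card B" "A \<inter> B = {}"
    and \<epsilon>: "\<And>n. n \<in> A \<union> B \<Longrightarrow> norm (\<epsilon> n) = 1"
    and D: "finite D"
  shows "seminorm_on D ((\<lambda>m. if m \<in> A then \<epsilon> m else 0) + f)
    \<le> seminorm_on ((D - A - B) \<union> B) ((\<lambda>m. if m \<in> B then \<epsilon> m else 0) + f)"
proof -
  define E where "E = D - A - B"
  define s where "s = (\<Sum>n\<in>E. norm (f n))"
  define t where "t = (\<Sum>\<^sub>\<infinity>n\<in>-E. f n)"
  define g where "g = (\<lambda>m. if m \<in> A then \<epsilon> m else 0)"
  define h where "h = (\<lambda>m. if m \<in> B then \<epsilon> m else 0)"
  have finE: "finite E" using D by (simp add: E_def)
  have s: "0 \<le> s" "s \<le> real (card E)"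
    using f(2) sum_bounded_above[of E "\<lambda>n. norm (f n)" 1] by (auto simp: s_def sum_nonneg)
  have DE: "D = E \<union> (D \<inter> A) \<union> (D \<inter> B)"
    by (auto simp: E_def)
  have "card D = card (E \<union> (D \<inter> A)) + card (D \<inter> B)"
    by (subst DE, rule card_Un_disjoint) (use AB D in \<open>auto simp: E_def\<close>)
  also have "card (E \<union> (D \<inter> A)) = card E + card (D \<inter> A)"
    by (rule card_Un_disjoint) (use D in \<open>auto simp: E_def\<close>)
  finally have cardD: "card D = card E + card (D \<inter> A) + card (D \<inter> B)" .
  have "(\<Sum>n\<in>D. norm ((g + f) n)) = (\<Sum>n\<in>E \<union> (D \<inter> A). norm ((g + f) n))"
    by (rule sum.mono_neutral_right) (use D AB f(3) in \<open>auto simp: E_def g_def\<close>)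
  also have "\<dots> = (\<Sum>n\<in>E. norm ((g + f) n)) + (\<Sum>n\<in>D \<inter> A. norm ((g + f) n))"
    by (rule sum.union_disjoint) (use D in \<open>auto simp: E_def\<close>)
  also have "(\<Sum>n\<in>E. norm ((g + f) n)) = s"
    unfolding s_def by (rule sum.cong) (auto simp: E_def g_def)
  also have "(\<Sum>n\<in>D \<inter> A. norm ((g + f) n)) = (\<Sum>n\<in>D \<inter> A. 1)"
    by (rule sum.cong) (use f(3) \<epsilon> in \<open>auto simp: g_def\<close>)
  finally have sumD: "(\<Sum>n\<in>D. norm ((g + f) n)) = s + real (card (D \<inter> A))"
    by simp
  have g: "g \<in> ell1"
    using AB by (intro ell1_finite_support[of A]) (auto simp: g_def)
  have "(\<Sum>\<^sub>\<infinity>n\<in>-D. (g + f) n) = (\<Sum>\<^sub>\<infinity>n\<in>-D. g n) + (\<Sum>\<^sub>\<infinity>n\<in>-D. f n)"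
    unfolding plus_fun_apply
    by (rule infsum_add) (use g f(1) ell1_summable in auto)
  also have "(\<Sum>\<^sub>\<infinity>n\<in>-D. g n) = (\<Sum>\<^sub>\<infinity>n\<in>A - D. \<epsilon> n)"
    by (rule infsum_cong_neutral) (auto simp: g_def)
  also have "\<dots> = (\<Sum>n\<in>A - D. \<epsilon> n)"
    using AB by simp
  also have "(\<Sum>\<^sub>\<infinity>n\<in>-D. f n) = t"
    unfolding t_def by (rule infsum_cong_neutral) (use f(3) in \<open>auto simp: E_def\<close>)
  finally have "norm (\<Sum>\<^sub>\<infinity>n\<in>-D. (g + f) n) \<le> norm (\<Sum>n\<in>A - D. \<epsilon> n) + norm t"
    using norm_triangle_ineq by metis
  moreover have "norm (\<Sum>n\<in>A - D. \<epsilon> n) \<le> real (card (A - D))"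
    using sum_norm_le[of "A - D" \<epsilon> "\<lambda>_. 1"] \<epsilon> by simp
  ultimately have tailD: "norm (\<Sum>\<^sub>\<infinity>n\<in>-D. (g + f) n) \<le> real (card (A - D)) + norm t"
    by linarith
  have "card A = card (D \<inter> A) + card (A - D)"
    using card_Int_Diff[OF AB(1), of D] by (simp add: Int_commute)
  then have cardA: "real (card (D \<inter> A)) + real (card (A - D)) \<le> real (card B)"
    using AB by simp
  have cardEB: "card (E \<union> B) = card E + card B"
    by (rule card_Un_disjoint) (use AB finE in \<open>auto simp: E_def\<close>)
  have "(\<Sum>n\<in>E \<union> B. norm ((h + f) n)) = (\<Sum>n\<in>E. norm ((h + f) n)) + (\<Sum>n\<in>B. norm ((h + f) n))"
    by (rule sum.union_disjoint) (use AB finE in \<open>auto simp: E_def\<close>)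
  also have "(\<Sum>n\<in>E. norm ((h + f) n)) = s"
    unfolding s_def by (rule sum.cong) (auto simp: E_def h_def)
  also have "(\<Sum>n\<in>B. norm ((h + f) n)) = (\<Sum>n\<in>B. 1)"
    by (rule sum.cong) (use f(3) \<epsilon> in \<open>auto simp: h_def\<close>)
  finally have sumEB: "(\<Sum>n\<in>E \<union> B. norm ((h + f) n)) = s + real (card B)"
    by simp
  have tailEB: "(\<Sum>\<^sub>\<infinity>n\<in>-(E \<union> B). (h + f) n) = t"
    unfolding t_def by (rule infsum_cong_neutral) (use f(3) in \<open>auto simp: h_def\<close>)
  have split: "seminorm_on C u = (\<Sum>n\<in>C. norm (u n))
      + 4 * ((\<Sum>n\<in>C. norm (u n)) / real (card C)) + norm (\<Sum>\<^sub>\<infinity>n\<in>-C. u n)"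
    for C and u :: "nat \<Rightarrow> 'f"
    by (simp add: seminorm_on_def distrib_right)
  have "(s + real (card (D \<inter> A))) / real (card D) \<le> (s + real (card B)) / real (card (E \<union> B))"
    using mean_mono[of s "real (card E)" "real (card (D \<inter> A))" "real (card B)"
        "real (card (D \<inter> B))"] s cardA
    by (simp add: cardD cardEB)
  then have "seminorm_on D (g + f) \<le> seminorm_on (E \<union> B) (h + f)"
    unfolding split sumD sumEB tailEB using tailD cardA by linarith
  then show ?thesis
    by (simp add: g_def h_def E_def)
qed

lemma avg_norm_property_A:
  "banach_basis.property_A (pointwise_scale :: 'f::{real_normed_field,banach} \<Rightarrow> _)
     ell1 avg_norm unit_vec coord"
  unfolding ell1.property_A_def
proof (intro ballI allI impI, elim conjE)
  fix f \<epsilon> :: "nat \<Rightarrow> 'f" and A B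
  assume f: "f \<in> ell1" "\<forall>n. norm (coord n f) \<le> 1"
    and disj: "A \<inter> ell1.supp f = {}" "B \<inter> ell1.supp f = {}"
    and AB: "finite A" "finite B" "card A \<le> card B" "A \<inter> B = {}"
    and \<epsilon>: "\<forall>n\<in>A \<union> B. norm (\<epsilon> n) = 1"
  have zero: "f n = 0" if "n \<in> A \<union> B" for n
    using disj that by (auto simp: ell1.supp_def coord_def)
  show "avg_norm (ell1.ind \<epsilon> A + f) \<le> avg_norm (ell1.ind \<epsilon> B + f)"
  proof (rule avg_norm_least)
    fix D :: "nat set" assume D: "finite D" "D \<noteq> {}"
    have "seminorm_on D (ell1.ind \<epsilon> A + f)
        \<le> seminorm_on ((D - A - B) \<union> B) (ell1.ind \<epsilon> B + f)"
      unfolding ind_eq[OF AB(1)] ind_eq[OF AB(2)]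
      using f AB \<epsilon> D zero by (intro seminorm_on_exchange) (auto simp: coord_def)
    also have "\<dots> \<le> avg_norm (ell1.ind \<epsilon> B + f)"
    proof (rule seminorm_le_avg_norm)
      show "ell1.ind \<epsilon> B + f \<in> ell1"
        using AB by (intro ell1_add f(1) ell1_finite_support[of B]) (auto simp: ind_eq)
      show "(D - A - B) \<union> B \<noteq> {}"
        using D AB by auto
    qed (use D AB in auto)
    finally show "seminorm_on D (ell1.ind \<epsilon> A + f) \<le> avg_norm (ell1.ind \<epsilon> B + f)" .
  qed
qed

section \<open>Failure of suppression unconditionality with constant 1\<close>

text \<open>
  The coordinates \<open>1/2\<close> and \<open>-1/2\<close> cancel outside \<open>{0}\<close>.
  Every other nonempty set contains an index besides 0, which lowers the mean to at most
  \<open>3/4\<close>: the value is then at most \<open>2 + 4 \<cdot> 3/4 = 5\<close>, no more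
  than the value \<open>1 + 4\<close> at \<open>{0}\<close>. Once \<open>-1/2\<close> is deleted,
  \<open>{0}\<close> gives \<open>1 + 4 + 1/2\<close>.
\<close>

lemma avg_norm_not_suppression_unconditional:
  "\<not> banach_basis.suppression_unconditional (pointwise_scale :: 'f::{real_normed_field,banach} \<Rightarrow> _)
     ell1 avg_norm unit_vec coord 1"
proof
  define f :: "nat \<Rightarrow> 'f" where
    "f = (\<lambda>n. if n = 0 then 1 else if n = 1 then 1 / 2 else if n = 2 then - (1 / 2) else 0)"
  let ?g = "\<lambda>m. if m \<in> {0, 1} then f m else 0"
  have f: "f \<in> ell1" and g: "?g \<in> ell1"
    by (auto intro!: ell1_finite_support[of "{0, 1, 2}"] simp: f_def split: if_splits)
  have l1: "l1norm f = 2"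
    by (subst l1norm_finite_support[of "{0, 1, 2}"]) (auto simp: f_def norm_divide)
  have half: "norm (f n) \<le> 1 / 2" if "n \<noteq> 0" for n
    using that by (simp add: f_def norm_divide)
  assume "banach_basis.suppression_unconditional (pointwise_scale :: 'f \<Rightarrow> _)
     ell1 avg_norm unit_vec coord 1"
  then have "avg_norm (ell1.coord_proj {0, 1} f) \<le> avg_norm f"
    using f by (auto simp: ell1.suppression_unconditional_def)
  moreover have "ell1.coord_proj {0, 1} f = ?g"
    unfolding ell1.coord_proj_def by (subst finite_combination) (auto simp: coord_def)
  moreover have "11 / 2 \<le> avg_norm ?g"
  proof -
    have "(\<Sum>\<^sub>\<infinity>n\<in>-{0}. ?g n) = (\<Sum>\<^sub>\<infinity>n\<in>{1}. ?g n)"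
      by (rule infsum_cong_neutral) auto
    also have "\<dots> = 1 / 2"
      by (simp add: f_def)
    finally have tail: "(\<Sum>\<^sub>\<infinity>n\<in>-{0}. ?g n) = 1 / 2" .
    have "seminorm_on {0} ?g = 11 / 2"
      unfolding seminorm_on_def tail by (simp add: f_def norm_divide)
    then show ?thesis
      using seminorm_le_avg_norm[OF g, of "{0}"] by simp
  qed
  moreover have "avg_norm f \<le> 5"
  proof (rule avg_norm_least)
    fix D :: "nat set" assume D: "finite D" "D \<noteq> {}"
    show "seminorm_on D f \<le> 5"
    proof (cases "D = {0}")
      case True
      have "(\<Sum>\<^sub>\<infinity>n\<in>-{0}. f n) = (\<Sum>\<^sub>\<infinity>n\<in>{1, 2}. f n)"
        by (rule infsum_cong_neutral) (auto simp: f_def)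
      then show ?thesis
        by (simp add: True seminorm_on_def f_def)
    next
      case False
      then have ne: "D - {0} \<noteq> {}" using D by auto
      let ?k = "real (card (D - {0}))"
      have k: "1 \<le> ?k"
        using ne D card_gt_0_iff[of "D - {0}"] by simp
      have rest: "(\<Sum>n\<in>D - {0}. norm (f n)) \<le> ?k * (1 / 2)"
        using sum_bounded_above[of "D - {0}" "\<lambda>n. norm (f n)" "1 / 2"] half by auto
      \<comment> \<open>Extremal case: the entry 1 and a single entry of modulus \<open>1/2\<close>.\<close>
      have "(\<Sum>n\<in>D. norm (f n)) \<le> 3 / 4 * real (card D)"
      proof (cases "0 \<in> D")
        case True
        have "(\<Sum>n\<in>D. norm (f n)) = 1 + (\<Sum>n\<in>D - {0}. norm (f n))"
          using sum.remove[OF D(1) True, of "\<lambda>n. norm (f n)"] by (simp add: f_def)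
        moreover have "real (card D) = 1 + ?k"
          using card.remove[OF D(1) True] by simp
        ultimately show ?thesis using rest k by linarith
      next
        case False
        then show ?thesis using rest k by simp
      qed
      then have "(\<Sum>n\<in>D. norm (f n)) / real (card D) \<le> 3 / 4"
        using D by (simp add: divide_le_eq card_gt_0_iff)
      then show ?thesis
        using seminorm_on_le_mean[OF f D(1)] l1 by linarith
    qed
  qed
  ultimately show False by simp
qed

lemma banach_basis_ell1:
  "banach_basis (pointwise_scale :: 'f::{real_normed_field,banach} \<Rightarrow> _) ell1 avg_norm unit_vec coord"
  by unfold_locales

theorem theorem1p7:
  shows "(\<exists>(scale :: real \<Rightarrow> (nat \<Rightarrow> real) \<Rightarrow> (nat \<Rightarrow> real)) V N x xs.
            banach_basis scale V N x xs \<and>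
            banach_basis.equivalent_to_l1 scale N x \<and>
            banach_basis.property_A scale V N x xs \<and>
            \<not> banach_basis.suppression_unconditional scale V N x xs 1 \<and>
            banach_basis.symmetric scale N x 1 \<and>
            banach_basis.bidemocratic scale V N x xs 1) \<and>
         (\<exists>(scale :: complex \<Rightarrow> (nat \<Rightarrow> complex) \<Rightarrow> (nat \<Rightarrow> complex)) V N x xs.
            banach_basis scale V N x xs \<and>
            banach_basis.equivalent_to_l1 scale N x \<and>
            banach_basis.property_A scale V N x xs \<and>
            \<not> banach_basis.suppression_unconditional scale V N x xs 1 \<and>
            banach_basis.symmetric scale N x 1 \<and>
            banach_basis.bidemocratic scale V N x xs 1)"
  by (rule conjI;
      rule exI[of _ pointwise_scale], rule exI[of _ ell1], rule exI[of _ avg_norm],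
      rule exI[of _ unit_vec], rule exI[of _ coord];
      intro conjI banach_basis_ell1 avg_norm_equivalent_to_l1 avg_norm_property_A
        avg_norm_not_suppression_unconditional avg_norm_symmetric avg_norm_bidemocratic)

end
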